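(* Let $m>0$, $g>0$, and let $\xi,\eta\colon\mathbb{R}\to\mathbb{R}$ be smooth $2\pi$-periodic functions; put $\rho(t)=\xi(t)e_x+\eta(t)e_y\in\mathbb{R}^3$. For any $\gamma>0$ there exist $r_0\in S^2$ and $\dot r_0\in T_{r_0}S^2$ such that the solution $r(\cdot)=r(\cdot,r_0,\dot r_0)\colon\mathbb{R}\to S^2$ of the inverted spherical pendulum equation $$m\ddot r(t)=\lambda(t)\,r(t)-mg\,e_z-m\ddot\rho(t)-\gamma\dot r(t),\qquad |r(t)|=1,$$ with initial conditions $r(0)=r_0$, $\dot r(0)=\dot r_0$, is periodic in $t$ and satisfies $(r(t),e_z)>0$ for all $t\in\mathbb{R}$.
   Context: $e_x,e_y,e_z$ is the standard orthonormal basis of $\mathbb{R}^3$ ($e_z$ points vertically upward, opposite to gravity), $(\cdot,\cdot)$ is the Euclidean inner product, and $S^2=\{r\in\mathbb{R}^3:|r|=1\}$. The equation describes a mass point of mass $m$ at the end of a rod of unit length whose pivot moves horizontally along $\rho(t)$; $r(t)$ is the position of the mass point relative to the pivot, in a frame with axes of fixed directions. The forces are gravity $-mg\,e_z$, viscous friction $-\gamma\dot r$ (with friction coefficient $\gamma>0$), and the constraint force $\lambda(t)r(t)$ parallel to $r(t)$. The scalar $\lambda(t)$ is an a priori unknown multiplier determined by the constraint $|r(t)|=1$; thus the equation is a smooth second-order ODE on $S^2$, $2\pi$-periodic in $t$, whose solution is determined by $(r_0,\dot r_0)$ in the tangent bundle $TS^2$. *)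

theory Defs
  imports "HOL-Analysis.Analysis"
begin

definition smooth :: "(real \<Rightarrow> real) \<Rightarrow> bool" where
  "smooth f \<longleftrightarrow> (\<forall>n t. (deriv ^^ n) f differentiable at t)"

text \<open>As for \<open>deriv\<close>, the value is meaningful only where \<open>f\<close> is differentiable.\<close>

definition curve_deriv :: "(real \<Rightarrow> real ^ 3) \<Rightarrow> real \<Rightarrow> real ^ 3" where
  "curve_deriv f t = vector_derivative f (at t)"

definition e_x :: "real ^ 3" where "e_x = axis 1 1"
definition e_y :: "real ^ 3" where "e_y = axis 2 1"
definition e_z :: "real ^ 3" where "e_z = axis 3 1"

abbreviation S2 :: "(real ^ 3) set" where
  "S2 \<equiv> sphere 0 1"

definition tangent_S2 :: "real ^ 3 \<Rightarrow> (real ^ 3) set" where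
  "tangent_S2 p = {v. v \<bullet> p = 0}"

definition pivot :: "(real \<Rightarrow> real) \<Rightarrow> (real \<Rightarrow> real) \<Rightarrow> real \<Rightarrow> real ^ 3" where
  "pivot \<xi> \<eta> t = \<xi> t *\<^sub>R e_x + \<eta> t *\<^sub>R e_y"

text \<open>
  The constraint multiplier \<open>\<Lambda>\<close> (\<open>\<lambda>\<close> in the usual notation) is not prescribed: it is an
  unknown of the problem, hence the existential quantifier.
\<close>

definition pendulum_solution ::
  "real \<Rightarrow> real \<Rightarrow> real \<Rightarrow> (real \<Rightarrow> real ^ 3) \<Rightarrow> real ^ 3 \<Rightarrow> real ^ 3 \<Rightarrow> (real \<Rightarrow> real ^ 3) \<Rightarrow> bool"
where
  "pendulum_solution m g \<gamma> \<rho> r0 v0 r \<longleftrightarrow>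
     (\<forall>t. r t \<in> S2) \<and>
     (\<forall>t. r differentiable at t) \<and>
     (\<forall>t. curve_deriv r differentiable at t) \<and>
     (\<exists>\<Lambda> :: real \<Rightarrow> real. \<forall>t.
        m *\<^sub>R curve_deriv (curve_deriv r) t =
          \<Lambda> t *\<^sub>R r t - (m * g) *\<^sub>R e_z - m *\<^sub>R curve_deriv (curve_deriv \<rho>) t
            - \<gamma> *\<^sub>R curve_deriv r t) \<and>
     r 0 = r0 \<and> curve_deriv r 0 = v0"

end

theory Submission
  imports Defs
begin

text \<open>
  In the gnomonic coordinate \<open>x\<close> of the upper hemisphere, \<open>r = (x, 1) / sqrt (1 + norm x ^ 2)\<close>,
  geodesics are straight lines, and the velocity variable \<open>y = x' / (1 + norm x ^ 2)\<close> absorbs the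
  quadratic velocity term: the equation becomes
  \<open>x' = (1 + norm x ^ 2) y\<close>, \<open>y' = - c y + (g x - \<rho>'') / sqrt (1 + norm x ^ 2)\<close> with
  \<open>c = \<gamma> / m\<close>. Gravity pushes \<open>x\<close> outwards for large \<open>x\<close>, so the maximum principle bounds \<open>x\<close>
  along a periodic solution; friction then bounds \<open>y\<close>. Hence the system may be replaced by a bounded
  Lipschitz perturbation of a linear saddle, for which a periodic solution is a fixed point of a
  continuous self-map of a product of two balls (Brouwer).
\<close>

section \<open>Ordinary differential equations with a global Lipschitz condition\<close>

lemma primitive_exists:
  fixes f :: "real \<Rightarrow> 'a::euclidean_space"
  assumes "continuous_on UNIV f"
  obtains F where "F 0 = 0" and "\<And>t. (F has_vector_derivative f t) (at t)"
proof -
  have "\<exists>F. \<forall>x::real. (-\<infinity>::ereal) < x \<longrightarrow> x < \<infinity> \<longrightarrow> (F has_vector_derivative f x) (at x)"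
    by (rule einterval_antiderivative)
       (use assms in \<open>auto simp: continuous_on_eq_continuous_at\<close>)
  then obtain F where F: "\<And>t. (F has_vector_derivative f t) (at t)"
    by auto
  show thesis
  proof
    show "((\<lambda>t. F t - F 0) has_vector_derivative f t) (at t)" for t
      using has_vector_derivative_diff[OF F has_vector_derivative_const] by simp
  qed simp
qed

text \<open>Integrating a function of growth \<open>exp (k * t)\<close> divides its bound by
  \<open>k\<close>. This gain makes the Picard operator contract in an exponentially weighted norm
  once \<open>k\<close> is large.\<close>

lemma primitive_exp_bound_nonneg:
  fixes f :: "real \<Rightarrow> 'a::euclidean_space"
  assumes F: "F 0 = 0" "\<And>t. (F has_vector_derivative f t) (at t)"
    and f: "\<And>t. norm (f t) \<le> B * exp (k * \<bar>t\<bar>)" and k: "k > 0" and t: "t \<ge> 0"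
  shows "norm (F t) \<le> B / k * (exp (k * t) - 1)"
proof (cases "t = 0")
  case False
  define \<phi> where "\<phi> s = B / k * exp (k * s)" for s
  have \<phi>: "(\<phi> has_vector_derivative B * exp (k * s)) (at s)" for s
    unfolding \<phi>_def has_real_derivative_iff_has_vector_derivative[symmetric]
    using k by (auto intro!: derivative_eq_intros)
  have "norm (F t - F 0) \<le> \<phi> t - \<phi> 0"
  proof (rule differentiable_bound_general)
    show "continuous_on {0..t} F" "continuous_on {0..t} \<phi>"
      using F(2) \<phi> by (meson continuous_at_imp_continuous_on has_vector_derivative_continuous)+
    show "norm (f s) \<le> B * exp (k * s)" if "0 < s" "s < t" for s
      using f[of s] that by simp
  qed (use False t F \<phi> in auto)
  then show ?thesis
    using F(1) by (simp add: \<phi>_def algebra_simps)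
qed (use F in simp)

text \<open>Negative times are reduced to positive ones by reflecting \<open>t\<close> to
  \<open>- t\<close>.\<close>

lemma primitive_exp_bound:
  fixes f :: "real \<Rightarrow> 'a::euclidean_space"
  assumes F: "F 0 = 0" "\<And>t. (F has_vector_derivative f t) (at t)"
    and f: "\<And>t. norm (f t) \<le> B * exp (k * \<bar>t\<bar>)" and k: "k > 0"
  shows "norm (F t) \<le> B / k * (exp (k * \<bar>t\<bar>) - 1)"
proof (cases "t \<ge> 0")
  case True
  then show ?thesis
    using primitive_exp_bound_nonneg[OF F f k] by simp
next
  case False
  have "((\<lambda>t. F (- t)) has_vector_derivative - f (- t)) (at t)" for t
    using vector_diff_chain_at[OF has_vector_derivative_minus[OF has_vector_derivative_id] F(2)]
    by (simp add: o_def)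
  then have "norm (F (- (- t))) \<le> B / k * (exp (k * - t) - 1)"
    using primitive_exp_bound_nonneg[of "\<lambda>t. F (- t)" "\<lambda>t. - f (- t)" B k "- t"]
      F(1) f[of "- t" for t] k False by simp
  then show ?thesis
    using False by simp
qed

text \<open>Joint continuity comes from splitting \<open>f t (v t) - f s (v s)\<close> into a change
  of the point, controlled by the Lipschitz bound uniformly in \<open>t\<close>, and a change of
  time at the fixed point \<open>v s\<close>.\<close>

lemma continuous_on_lipschitz_family:
  fixes f :: "real \<Rightarrow> 'a::real_normed_vector \<Rightarrow> 'b::real_normed_vector"
  assumes lip: "\<And>t x y. norm (f t x - f t y) \<le> L * norm (x - y)"
    and cont: "\<And>x. continuous_on UNIV (\<lambda>t. f t x)" and v: "continuous_on UNIV v"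
  shows "continuous_on UNIV (\<lambda>t. f t (v t))"
  unfolding continuous_on_eq_continuous_at[OF open_UNIV]
proof
  fix s :: real
  have "((\<lambda>t. f t (v t) - f t (v s)) \<longlongrightarrow> 0) (at s)"
  proof (rule Lim_null_comparison)
    show "\<forall>\<^sub>F t in at s. norm (f t (v t) - f t (v s)) \<le> L * norm (v t - v s)"
      using lip by simp
    have "(v \<longlongrightarrow> v s) (at s)"
      using v by (simp add: continuous_on_def)
    then show "((\<lambda>t. L * norm (v t - v s)) \<longlongrightarrow> 0) (at s)"
      by (auto intro!: tendsto_eq_intros)
  qed
  moreover have "((\<lambda>t. f t (v s)) \<longlongrightarrow> f s (v s)) (at s)"
    using cont by (simp add: continuous_on_def)
  ultimately have "((\<lambda>t. (f t (v t) - f t (v s)) + f t (v s)) \<longlongrightarrow> 0 + f s (v s)) (at s)"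
    by (rule tendsto_add)
  then show "isCont (\<lambda>t. f t (v t)) s"
    by (simp add: isCont_def)
qed

text \<open>One application of Banach's fixed point theorem on the whole line: the solution is
  sought as \<open>exp (k * \<bar>t\<bar>)\<close> times a bounded continuous function, which turns
  the sup norm into a Bielecki norm. The bound on \<open>f t 0\<close> keeps the Picard iterates
  within this growth.\<close>

lemma lipschitz_ivp_exists:
  fixes f :: "real \<Rightarrow> 'a::euclidean_space \<Rightarrow> 'a"
  assumes L: "L > 0" and lip: "\<And>t x y. norm (f t x - f t y) \<le> L * norm (x - y)"
    and cont: "\<And>x. continuous_on UNIV (\<lambda>t. f t x)" and bdd: "\<And>t. norm (f t 0) \<le> C"
  obtains z where "z 0 = z0" and "\<And>t. (z has_vector_derivative f t (z t)) (at t)"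
proof -
  \<comment> \<open>The contraction factor is \<open>L / k\<close>, here one half.\<close>
  define k where "k = 2 * L"
  have k: "k > 0" using L by (simp add: k_def)
  define g where "g v s = f s (exp (k * \<bar>s\<bar>) *\<^sub>R apply_bcontfun v s)" for v :: "real \<Rightarrow>\<^sub>C 'a" and s
  have gc: "continuous_on UNIV (g v)" for v
    unfolding g_def
    by (rule continuous_on_lipschitz_family[OF lip cont]) (auto intro!: continuous_intros)
  have "\<exists>G. \<forall>v. G v 0 = 0 \<and> (\<forall>t. (G v has_vector_derivative g v t) (at t))"
    by (rule choice) (metis primitive_exists[OF gc])
  then obtain G where G: "\<And>v. G v 0 = 0" "\<And>v t. (G v has_vector_derivative g v t) (at t)"
    by blast
  have Gc: "continuous_on UNIV (G v)" for v
    using G(2) by (meson continuous_at_imp_continuous_on has_vector_derivative_continuous)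
  have exp1: "1 \<le> exp (k * \<bar>s\<bar>)" for s
    using k by simp
  have C0: "C \<ge> 0" using bdd[of 0] norm_ge_zero order_trans by blast
  have gb: "norm (g v s) \<le> (C + L * norm v) * exp (k * \<bar>s\<bar>)" for v s
  proof -
    have "norm (g v s) \<le> norm (f s 0) + norm (g v s - f s 0)"
      using norm_triangle_sub by blast
    also have "\<dots> \<le> C + L * (exp (k * \<bar>s\<bar>) * norm (apply_bcontfun v s))"
      using bdd[of s] lip[of s "exp (k * \<bar>s\<bar>) *\<^sub>R apply_bcontfun v s" 0]
      by (simp add: g_def)
    also have "\<dots> \<le> C * exp (k * \<bar>s\<bar>) + L * (exp (k * \<bar>s\<bar>) * norm v)"
      using L C0 exp1[of s] norm_bounded[of v s]
      by (intro add_mono mult_left_mono) (auto simp: mult_le_cancel_left1)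
    finally show ?thesis by (simp add: algebra_simps)
  qed
  \<comment> \<open>The Picard operator, with the weight removed again from its result.\<close>
  define K where "K v t = exp (- k * \<bar>t\<bar>) *\<^sub>R (z0 + G v t)" for v t
  have Kb: "K v \<in> bcontfun" for v
  proof (rule bcontfun_normI)
    show "continuous_on UNIV (K v)"
      unfolding K_def by (intro continuous_intros Gc)
    fix t
    let ?M = "(C + L * norm v) / k"
    have M: "?M \<ge> 0" using C0 L k by simp
    have "norm (z0 + G v t) \<le> norm z0 + ?M * (exp (k * \<bar>t\<bar>) - 1)"
      using primitive_exp_bound[OF G gb k, of v t] norm_triangle_ineq[of z0 "G v t"] by linarith
    also have "\<dots> \<le> norm z0 * exp (k * \<bar>t\<bar>) + ?M * exp (k * \<bar>t\<bar>)"
      using M exp1[of t] by (intro add_mono mult_left_mono) (auto simp: mult_le_cancel_left1)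
    finally have "norm (z0 + G v t) \<le> (norm z0 + ?M) * exp (k * \<bar>t\<bar>)"
      by (simp add: algebra_simps)
    moreover have "norm (K v t) = norm (z0 + G v t) / exp (k * \<bar>t\<bar>)"
      unfolding K_def norm_scaleR by (simp add: exp_minus divide_inverse)
    ultimately show "norm (K v t) \<le> norm z0 + ?M"
      by (simp add: pos_divide_le_eq)
  qed
  have "dist (Bcontfun (K v)) (Bcontfun (K w)) \<le> 1 / 2 * dist v w" for v w
  proof (rule dist_bound)
    fix t
    have gd: "norm (g v s - g w s) \<le> (L * dist v w) * exp (k * \<bar>s\<bar>)" for s
    proof -
      have "norm (g v s - g w s) \<le>
          L * (exp (k * \<bar>s\<bar>) * dist (apply_bcontfun v s) (apply_bcontfun w s))"
        using lip[of s "exp (k * \<bar>s\<bar>) *\<^sub>R apply_bcontfun v s"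
            "exp (k * \<bar>s\<bar>) *\<^sub>R apply_bcontfun w s"]
        by (simp add: g_def dist_norm flip: scaleR_diff_right)
      also have "\<dots> \<le> L * (exp (k * \<bar>s\<bar>) * dist v w)"
        using L dist_bounded[of v s w] by (intro mult_left_mono) auto
      finally show ?thesis by (simp add: algebra_simps)
    qed
    have "norm (G v t - G w t) \<le> L * dist v w / k * (exp (k * \<bar>t\<bar>) - 1)"
      using primitive_exp_bound[of "\<lambda>t. G v t - G w t" "\<lambda>t. g v t - g w t" "L * dist v w" k t]
        G gd k by (auto intro!: has_vector_derivative_diff)
    also have "\<dots> \<le> 1 / 2 * dist v w * exp (k * \<bar>t\<bar>)"
      using L by (simp add: k_def field_simps)
    finally have "norm (G v t - G w t) / exp (k * \<bar>t\<bar>) \<le> 1 / 2 * dist v w"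
      by (simp add: pos_divide_le_eq)
    moreover have "K v t - K w t = exp (- k * \<bar>t\<bar>) *\<^sub>R (G v t - G w t)"
      by (simp add: K_def algebra_simps)
    then have "norm (K v t - K w t) = norm (G v t - G w t) / exp (k * \<bar>t\<bar>)"
      by (simp only: norm_scaleR) (simp add: exp_minus divide_inverse)
    ultimately show "dist (apply_bcontfun (Bcontfun (K v)) t) (apply_bcontfun (Bcontfun (K w)) t)
        \<le> 1 / 2 * dist v w"
      by (simp add: Bcontfun_inverse[OF Kb] dist_norm)
  qed
  then obtain v where v: "Bcontfun (K v) = v"
    using banach_fix_type[of "1 / 2" "\<lambda>v. Bcontfun (K v)"] by auto
  \<comment> \<open>Multiplying by the weight turns the fixed point equation for \<open>v\<close>
    into the integral equation for \<open>z0 + G v t\<close>.\<close>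
  have vt: "exp (k * \<bar>t\<bar>) *\<^sub>R apply_bcontfun v t = z0 + G v t" for t
  proof -
    have "apply_bcontfun v t = K v t"
      by (metis v Bcontfun_inverse[OF Kb])
    also have "\<dots> = exp (- k * \<bar>t\<bar>) *\<^sub>R (z0 + G v t)"
      by (simp only: K_def)
    finally show ?thesis
      by (simp only: scaleR_scaleR) (simp flip: exp_add)
  qed
  show thesis
  proof
    show "z0 + G v 0 = z0" by (simp add: G)
    show "((\<lambda>t. z0 + G v t) has_vector_derivative f t (z0 + G v t)) (at t)" for t
      using has_vector_derivative_add[OF has_vector_derivative_const G(2), of z0 v t]
      by (simp add: g_def vt)
  qed
qed

section \<open>Dependence on initial values and comparison with a linear flow\<close>

lemma has_real_derivative_inner:
  fixes u v :: "real \<Rightarrow> 'a::real_inner"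
  assumes "(u has_vector_derivative u') (at t)" and "(v has_vector_derivative v') (at t)"
  shows "((\<lambda>t. u t \<bullet> v t) has_real_derivative u' \<bullet> v t + u t \<bullet> v') (at t)"
  using has_derivative_inner[OF assms[unfolded has_vector_derivative_def]]
  by (auto simp: has_field_derivative_def fun_eq_iff algebra_simps elim!: has_derivative_eq_rhs)

text \<open>A differential form of Gronwall's inequality: by Cauchy-Schwarz, the squared distance
  multiplied by \<open>exp (- 2 * L * t)\<close> has nonpositive derivative.\<close>

lemma lipschitz_ivp_dist_nonneg:
  fixes f :: "real \<Rightarrow> 'a::real_inner \<Rightarrow> 'a"
  assumes lip: "\<And>t x y. norm (f t x - f t y) \<le> L * norm (x - y)"
    and u: "\<And>t. (u has_vector_derivative f t (u t)) (at t)"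
    and v: "\<And>t. (v has_vector_derivative f t (v t)) (at t)" and t: "t \<ge> 0"
  shows "norm (u t - v t) \<le> exp (L * t) * norm (u 0 - v 0)"
proof -
  define e where "e t = exp (- 2 * L * t) * ((u t - v t) \<bullet> (u t - v t))" for t
  have e': "(e has_real_derivative
      exp (- 2 * L * t) * (2 * ((u t - v t) \<bullet> (f t (u t) - f t (v t)))
        - 2 * L * ((u t - v t) \<bullet> (u t - v t)))) (at t)" for t
  proof -
    have d: "((\<lambda>t. u t - v t) has_vector_derivative f t (u t) - f t (v t)) (at t)"
      by (intro has_vector_derivative_diff u v)
    have "((\<lambda>t. exp (- 2 * L * t)) has_real_derivative exp (- 2 * L * t) * (- 2 * L)) (at t)"
      by (auto intro!: derivative_eq_intros)
    from DERIV_mult[OF this has_real_derivative_inner[OF d d]] show ?thesis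
      unfolding e_def by (rule DERIV_cong) (simp add: inner_commute[of "f t (u t)"]
          inner_commute[of "f t (v t)"] algebra_simps)
  qed
  have "(u t - v t) \<bullet> (f t (u t) - f t (v t)) \<le> L * ((u t - v t) \<bullet> (u t - v t))" for t
  proof -
    have "(u t - v t) \<bullet> (f t (u t) - f t (v t))
        \<le> norm (u t - v t) * norm (f t (u t) - f t (v t))"
      by (rule norm_cauchy_schwarz)
    also have "\<dots> \<le> norm (u t - v t) * (L * norm (u t - v t))"
      by (intro mult_left_mono lip) auto
    finally show ?thesis
      by (simp add: power2_norm_eq_inner[symmetric] power2_eq_square algebra_simps)
  qed
  then have "e t \<le> e 0"
    using t e' by (intro DERIV_nonpos_imp_nonincreasing[OF t])
      (auto intro!: exI[of _ "exp _ * _"] mult_nonneg_nonpos)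
  then have "(norm (u t - v t))\<^sup>2 \<le> exp (2 * L * t) * (norm (u 0 - v 0))\<^sup>2"
    by (simp add: e_def power2_norm_eq_inner exp_minus field_simps)
  also have "\<dots> = (exp (L * t) * norm (u 0 - v 0))\<^sup>2"
    by (simp add: power_mult_distrib exp_double[symmetric] mult.assoc)
  finally show ?thesis
    by (rule power2_le_imp_le) simp
qed

text \<open>This serves twice: it makes the time \<open>T\<close> map continuous, as Brouwer's
  theorem requires, and for equal initial values it is uniqueness in both time directions.\<close>

lemma lipschitz_ivp_dist:
  fixes f :: "real \<Rightarrow> 'a::real_inner \<Rightarrow> 'a"
  assumes lip: "\<And>t x y. norm (f t x - f t y) \<le> L * norm (x - y)"
    and u: "\<And>t. (u has_vector_derivative f t (u t)) (at t)"
    and v: "\<And>t. (v has_vector_derivative f t (v t)) (at t)"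
  shows "norm (u t - v t) \<le> exp (L * \<bar>t\<bar>) * norm (u 0 - v 0)"
proof (cases "t \<ge> 0")
  case True
  then show ?thesis
    using lipschitz_ivp_dist_nonneg[OF lip u v] by simp
next
  case False
  have reflect: "((\<lambda>t. w (- t)) has_vector_derivative - f (- t) (w (- t))) (at t)"
    if "\<And>t. (w has_vector_derivative f t (w t)) (at t)" for w t
    using vector_diff_chain_at[OF has_vector_derivative_minus[OF has_vector_derivative_id] that]
    by (simp add: o_def)
  have "norm (u (- (- t)) - v (- (- t))) \<le> exp (L * - t) * norm (u (- 0) - v (- 0))"
    using False
    by (intro lipschitz_ivp_dist_nonneg[of "\<lambda>t x. - f (- t) x" L "\<lambda>t. u (- t)" "\<lambda>t. v (- t)"])
       (auto intro!: reflect u v simp: norm_minus_commute lip)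
  then show ?thesis
    using False by simp
qed

text \<open>Variation of constants: over time \<open>T\<close> a bounded perturbation moves the
  linear flow by an amount independent of \<open>u 0\<close>. The absolute value of \<open>a\<close>
  lets one bound serve the expanding and the contracting direction.\<close>

lemma scalar_linear_bound:
  fixes u :: "real \<Rightarrow> 'a::euclidean_space"
  assumes u: "\<And>t. (u has_vector_derivative a *\<^sub>R u t + n t) (at t)"
    and n: "\<And>t. norm (n t) \<le> C" and T: "T \<ge> 0"
  shows "norm (u T - exp (a * T) *\<^sub>R u 0) \<le> exp (\<bar>a\<bar> * T) * exp (\<bar>a\<bar> * T) * (C * T)"
proof (cases "T = 0")
  case False
  \<comment> \<open>The integrating factor removes the linear term, so the derivative of
    \<open>v\<close> involves only \<open>n\<close>.\<close>
  define v where "v t = exp (- a * t) *\<^sub>R u t" for t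
  have v': "(v has_vector_derivative exp (- a * t) *\<^sub>R n t) (at t)" for t
    unfolding v_def has_real_derivative_iff_has_vector_derivative[symmetric]
    by (rule has_vector_derivative_eq_rhs, rule has_vector_derivative_scaleR[OF _ u])
       (auto intro!: derivative_eq_intros simp: algebra_simps)
  have C: "C \<ge> 0" using n[of 0] norm_ge_zero order_trans by blast
  have "norm (v T - v 0) \<le> exp (\<bar>a\<bar> * T) * C * T - exp (\<bar>a\<bar> * T) * C * 0"
  proof (rule differentiable_bound_general[where \<phi>' = "\<lambda>t. exp (\<bar>a\<bar> * T) * C"])
    show "continuous_on {0..T} v"
      using v' by (meson continuous_at_imp_continuous_on has_vector_derivative_continuous)
    show "(v has_vector_derivative exp (- a * t) *\<^sub>R n t) (at t)" for t
      by (rule v')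
    show "((\<lambda>t. exp (\<bar>a\<bar> * T) * C * t) has_vector_derivative exp (\<bar>a\<bar> * T) * C) (at t)" for t
      unfolding has_real_derivative_iff_has_vector_derivative[symmetric]
      by (auto intro!: derivative_eq_intros)
    fix t assume t: "0 < t" "t < T"
    have "- a * t \<le> \<bar>a\<bar> * T"
      using t by (intro mult_mono) auto
    then have "exp (- a * t) * norm (n t) \<le> exp (\<bar>a\<bar> * T) * C"
      using n[of t] C by (intro mult_mono) auto
    then show "norm (exp (- a * t) *\<^sub>R n t) \<le> exp (\<bar>a\<bar> * T) * C"
      by simp
  qed (use False T in \<open>auto intro!: continuous_intros\<close>)
  moreover have "u T - exp (a * T) *\<^sub>R u 0 = exp (a * T) *\<^sub>R (v T - v 0)"
    by (simp add: v_def algebra_simps flip: exp_add)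
  moreover have "exp (a * T) \<le> exp (\<bar>a\<bar> * T)"
    using T by (simp add: mult_right_mono)
  ultimately show ?thesis
    using mult_mono[of "exp (a * T)" "exp (\<bar>a\<bar> * T)" "norm (v T - v 0)" "exp (\<bar>a\<bar> * T) * C * T"]
    by (simp add: mult.assoc)
qed simp

text \<open>A fixed point of the Poincare map \<open>(u, w) \<mapsto> (exp (a T) u + b\<^sub>1, exp (k T) w + b\<^sub>2)\<close>
  with bounded \<open>b\<^sub>1\<close>, \<open>b\<^sub>2\<close> is a fixed point of
  \<open>(u, w) \<mapsto> (- b\<^sub>1 / (exp (a T) - 1), b\<^sub>2 / (1 - exp (k T)))\<close>, which maps a compact
  convex set to itself.\<close>

lemma hyperbolic_periodic_solution:
  fixes n\<^sub>1 :: "real \<Rightarrow> ('a::euclidean_space) \<times> ('b::euclidean_space) \<Rightarrow> 'a"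
    and n\<^sub>2 :: "real \<Rightarrow> 'a \<times> 'b \<Rightarrow> 'b"
  assumes a: "a > 0" and k: "k < 0" and T: "T > 0"
    and lip\<^sub>1: "\<And>t x y. norm (n\<^sub>1 t x - n\<^sub>1 t y) \<le> L * norm (x - y)"
    and lip\<^sub>2: "\<And>t x y. norm (n\<^sub>2 t x - n\<^sub>2 t y) \<le> L * norm (x - y)"
    and bdd\<^sub>1: "\<And>t x. norm (n\<^sub>1 t x) \<le> C" and bdd\<^sub>2: "\<And>t x. norm (n\<^sub>2 t x) \<le> C"
    and cont\<^sub>1: "\<And>x. continuous_on UNIV (\<lambda>t. n\<^sub>1 t x)"
    and cont\<^sub>2: "\<And>x. continuous_on UNIV (\<lambda>t. n\<^sub>2 t x)"
    and per\<^sub>1: "\<And>t x. n\<^sub>1 (t + T) x = n\<^sub>1 t x" and per\<^sub>2: "\<And>t x. n\<^sub>2 (t + T) x = n\<^sub>2 t x"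
  obtains u w where "\<And>t. (u has_vector_derivative a *\<^sub>R u t + n\<^sub>1 t (u t, w t)) (at t)"
    and "\<And>t. (w has_vector_derivative k *\<^sub>R w t + n\<^sub>2 t (u t, w t)) (at t)"
    and "\<And>t. u (t + T) = u t" and "\<And>t. w (t + T) = w t"
proof -
  define f where "f t z = (a *\<^sub>R fst z + n\<^sub>1 t z, k *\<^sub>R snd z + n\<^sub>2 t z)" for t z
  define M where "M = \<bar>a\<bar> + \<bar>k\<bar> + 2 * \<bar>L\<bar> + 1"
  have M: "M > 0" by (simp add: M_def add_nonneg_pos)
  have lip: "norm (f t x - f t y) \<le> M * norm (x - y)" for t x y
  proof -
    have "norm (f t x - f t y) \<le> norm (a *\<^sub>R fst (x - y) + (n\<^sub>1 t x - n\<^sub>1 t y))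
        + norm (k *\<^sub>R snd (x - y) + (n\<^sub>2 t x - n\<^sub>2 t y))"
      by (rule order_trans[OF _ norm_Pair_le]) (simp add: f_def algebra_simps)
    also have "\<dots> \<le> (\<bar>a\<bar> * norm (fst (x - y)) + \<bar>L\<bar> * norm (x - y))
        + (\<bar>k\<bar> * norm (snd (x - y)) + \<bar>L\<bar> * norm (x - y))"
      using lip\<^sub>1[of t x y] lip\<^sub>2[of t x y] mult_right_mono[OF abs_ge_self norm_ge_zero, of L "x - y"]
      by (intro add_mono order_trans[OF norm_triangle_ineq]) auto
    also have "\<dots> \<le> (\<bar>a\<bar> * norm (x - y) + \<bar>L\<bar> * norm (x - y))
        + (\<bar>k\<bar> * norm (x - y) + \<bar>L\<bar> * norm (x - y))"
      using norm_fst_le[of "fst (x - y)" "snd (x - y)"] norm_snd_le[of "snd (x - y)" "fst (x - y)"]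
      by (intro add_mono mult_left_mono) (simp_all only: prod.collapse abs_ge_zero order_refl)
    also have "\<dots> \<le> M * norm (x - y)"
      by (simp add: M_def algebra_simps)
    finally show ?thesis .
  qed
  have cont: "continuous_on UNIV (\<lambda>t. f t x)" for x
    unfolding f_def by (intro continuous_intros cont\<^sub>1 cont\<^sub>2)
  have bdd: "norm (f t 0) \<le> 2 * C" for t
    using norm_Pair_le[of "n\<^sub>1 t 0" "n\<^sub>2 t 0"] bdd\<^sub>1[of t 0] bdd\<^sub>2[of t 0] by (simp add: f_def)
  have "\<exists>\<phi>. \<forall>z0. \<phi> z0 0 = z0 \<and> (\<forall>t. (\<phi> z0 has_vector_derivative f t (\<phi> z0 t)) (at t))"
    by (rule choice) (metis lipschitz_ivp_exists[OF M lip cont bdd])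
  then obtain \<phi> where \<phi>0: "\<And>z. \<phi> z 0 = z"
    and \<phi>: "\<And>z t. (\<phi> z has_vector_derivative f t (\<phi> z t)) (at t)"
    by blast
  have \<phi>1: "((\<lambda>t. fst (\<phi> z t)) has_vector_derivative a *\<^sub>R fst (\<phi> z t) + n\<^sub>1 t (\<phi> z t)) (at t)" for z t
    using bounded_linear.has_vector_derivative[OF bounded_linear_fst \<phi>, of z t] by (simp add: f_def)
  have \<phi>2: "((\<lambda>t. snd (\<phi> z t)) has_vector_derivative k *\<^sub>R snd (\<phi> z t) + n\<^sub>2 t (\<phi> z t)) (at t)" for z t
    using bounded_linear.has_vector_derivative[OF bounded_linear_snd \<phi>, of z t] by (simp add: f_def)
  have \<phi>c: "continuous_on UNIV (\<lambda>z. \<phi> z T)"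
  proof (rule lipschitz_on_continuous_on)
    show "(exp (M * \<bar>T\<bar>))-lipschitz_on UNIV (\<lambda>z. \<phi> z T)"
    proof (rule lipschitz_onI)
      show "dist (\<phi> x T) (\<phi> y T) \<le> exp (M * \<bar>T\<bar>) * dist x y" for x y
        using lipschitz_ivp_dist[of f M "\<phi> x" "\<phi> y" T] lip \<phi> by (simp add: dist_norm \<phi>0)
    qed simp
  qed
  define \<alpha> where "\<alpha> = exp (a * T) - 1"
  define \<beta> where "\<beta> = 1 - exp (k * T)"
  have \<alpha>: "\<alpha> > 0" and \<beta>: "\<beta> > 0"
    using a k T by (auto simp: \<alpha>_def \<beta>_def mult_neg_pos)
  \<comment> \<open>In this form a fixed point of \<Psi> is visibly a fixed point of the time
    \<open>T\<close> map. The rewriting below cancels the linear part and shows that \<Psi> is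
    bounded.\<close>
  define \<Psi> where "\<Psi> z = (fst z - (1 / \<alpha>) *\<^sub>R (fst (\<phi> z T) - fst z),
      snd z + (1 / \<beta>) *\<^sub>R (snd (\<phi> z T) - snd z))" for z
  define D\<^sub>1 where "D\<^sub>1 = exp (\<bar>a\<bar> * T) * exp (\<bar>a\<bar> * T) * (C * T)"
  define D\<^sub>2 where "D\<^sub>2 = exp (\<bar>k\<bar> * T) * exp (\<bar>k\<bar> * T) * (C * T)"
  have D\<^sub>1: "norm (fst (\<phi> z T) - exp (a * T) *\<^sub>R fst z) \<le> D\<^sub>1" for z
    using scalar_linear_bound[of "\<lambda>t. fst (\<phi> z t)" a "\<lambda>t. n\<^sub>1 t (\<phi> z t)" C T] \<phi>1 bdd\<^sub>1 T
    by (simp add: \<phi>0 D\<^sub>1_def)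
  have D\<^sub>2: "norm (snd (\<phi> z T) - exp (k * T) *\<^sub>R snd z) \<le> D\<^sub>2" for z
    using scalar_linear_bound[of "\<lambda>t. snd (\<phi> z t)" k "\<lambda>t. n\<^sub>2 t (\<phi> z t)" C T] \<phi>2 bdd\<^sub>2 T
    by (simp add: \<phi>0 D\<^sub>2_def)
  have D0: "D\<^sub>1 \<ge> 0" "D\<^sub>2 \<ge> 0"
    using D\<^sub>1 D\<^sub>2 norm_ge_zero order_trans by blast+
  have "\<Psi> z = (- ((1 / \<alpha>) *\<^sub>R (fst (\<phi> z T) - exp (a * T) *\<^sub>R fst z)),
      (1 / \<beta>) *\<^sub>R (snd (\<phi> z T) - exp (k * T) *\<^sub>R snd z))" for z
  proof -
    have "fst z = (1 / \<alpha>) *\<^sub>R (\<alpha> *\<^sub>R fst z)" "snd z = (1 / \<beta>) *\<^sub>R (\<beta> *\<^sub>R snd z)"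
      using \<alpha> \<beta> by auto
    then have "\<Psi> z = ((1 / \<alpha>) *\<^sub>R (\<alpha> *\<^sub>R fst z) - (1 / \<alpha>) *\<^sub>R (fst (\<phi> z T) - fst z),
      (1 / \<beta>) *\<^sub>R (\<beta> *\<^sub>R snd z) + (1 / \<beta>) *\<^sub>R (snd (\<phi> z T) - snd z))"
      by (simp add: \<Psi>_def)
    also have "\<dots> = ((1 / \<alpha>) *\<^sub>R (\<alpha> *\<^sub>R fst z - (fst (\<phi> z T) - fst z)),
      (1 / \<beta>) *\<^sub>R (\<beta> *\<^sub>R snd z + (snd (\<phi> z T) - snd z)))"
      by (simp only: scaleR_diff_right scaleR_add_right)
    also have "\<alpha> *\<^sub>R fst z - (fst (\<phi> z T) - fst z) = - (fst (\<phi> z T) - exp (a * T) *\<^sub>R fst z)"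
      by (simp add: \<alpha>_def algebra_simps)
    also have "\<beta> *\<^sub>R snd z + (snd (\<phi> z T) - snd z) = snd (\<phi> z T) - exp (k * T) *\<^sub>R snd z"
      by (simp add: \<beta>_def algebra_simps)
    finally show ?thesis by (simp only: scaleR_minus_right)
  qed
  then have \<Psi>: "\<Psi> z \<in> cball 0 (D\<^sub>1 / \<alpha>) \<times> cball 0 (D\<^sub>2 / \<beta>)" for z
    using D\<^sub>1[of z] D\<^sub>2[of z] \<alpha> \<beta> by (simp add: divide_right_mono)
  obtain z where z: "\<Psi> z = z"
  proof (rule brouwer[of "cball 0 (D\<^sub>1 / \<alpha>) \<times> cball 0 (D\<^sub>2 / \<beta>)" \<Psi>])
    show "continuous_on (cball 0 (D\<^sub>1 / \<alpha>) \<times> cball 0 (D\<^sub>2 / \<beta>)) \<Psi>"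
      unfolding \<Psi>_def
      by (rule continuous_on_subset[of UNIV]) (auto intro!: continuous_intros \<phi>c)
  qed (use \<Psi> D0 \<alpha> \<beta> in \<open>auto simp: compact_Times convex_Times\<close>)
  have "fst (\<Psi> z) = fst z" "snd (\<Psi> z) = snd z"
    using z by simp_all
  then have zT: "\<phi> z T = z"
    using \<alpha> \<beta> by (auto simp: \<Psi>_def prod_eq_iff)
  \<comment> \<open>The shifted curve solves the same equation with the same initial value
    \<open>z\<close>, so uniqueness makes it equal to the original one.\<close>
  have "((\<lambda>t. \<phi> z (t + T)) has_vector_derivative f t (\<phi> z (t + T))) (at t)" for t
  proof -
    have "f (t + T) = f t"
      by (simp add: f_def per\<^sub>1 per\<^sub>2 fun_eq_iff)
    moreover have "((\<lambda>t. t + T) has_vector_derivative 1 + 0) (at t)"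
      by (intro has_vector_derivative_add has_vector_derivative_id has_vector_derivative_const)
    ultimately show ?thesis
      using vector_diff_chain_at[OF _ \<phi>, of "\<lambda>t. t + T" 1 t z] by (simp add: o_def)
  qed
  then have per: "\<phi> z (t + T) = \<phi> z t" for t
    using lipschitz_ivp_dist[of f M "\<lambda>t. \<phi> z (t + T)" "\<phi> z" t] lip \<phi> by (simp add: \<phi>0 zT)
  show thesis
    by (rule that[of "\<lambda>t. fst (\<phi> z t)" "\<lambda>t. snd (\<phi> z t)"]) (use \<phi>1 \<phi>2 per in auto)
qed

section \<open>Bounded Lipschitz perturbations of a saddle\<close>

text \<open>The class of admissible perturbations. Closure under sums, products and Lipschitz
  substitutions allows the truncated nonlinearity to be handled without tracking constants.\<close>

definition bdd_lip :: "(real \<Rightarrow> 'a::real_normed_vector \<Rightarrow> 'b::real_normed_vector) \<Rightarrow> bool" where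
  "bdd_lip f \<longleftrightarrow> (\<exists>C L. (\<forall>t x. norm (f t x) \<le> C) \<and>
     (\<forall>t x y. norm (f t x - f t y) \<le> L * norm (x - y)) \<and>
     (\<forall>x. continuous_on UNIV (\<lambda>t. f t x)))"

lemma bdd_lipI:
  assumes "\<And>t x. norm (f t x) \<le> C" and "\<And>t x y. norm (f t x - f t y) \<le> L * norm (x - y)"
    and "\<And>x. continuous_on UNIV (\<lambda>t. f t x)"
  shows "bdd_lip f"
  using assms unfolding bdd_lip_def by blast

lemma bdd_lipE:
  assumes "bdd_lip f"
  obtains C L where "C \<ge> 0" and "L \<ge> 0" and "\<And>t x. norm (f t x) \<le> C"
    and "\<And>t x y. norm (f t x - f t y) \<le> L * norm (x - y)"
    and "\<And>x. continuous_on UNIV (\<lambda>t. f t x)"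
proof -
  obtain C L where *: "\<And>t x. norm (f t x) \<le> C"
      "\<And>t x y. norm (f t x - f t y) \<le> L * norm (x - y)"
      "\<And>x. continuous_on UNIV (\<lambda>t. f t x)"
    using assms unfolding bdd_lip_def by blast
  show thesis
  proof (rule that[of C "\<bar>L\<bar>"])
    show "C \<ge> 0" using *(1) norm_ge_zero order_trans by blast
    show "norm (f t x - f t y) \<le> \<bar>L\<bar> * norm (x - y)" for t x y
      using *(2)[of t x y] mult_right_mono[OF abs_ge_self norm_ge_zero, of L "x - y"] by linarith
  qed (use * in auto)
qed

lemma bdd_lip_add:
  assumes "bdd_lip f" and "bdd_lip g"
  shows "bdd_lip (\<lambda>t x. f t x + g t x)"
proof -
  obtain C L where f: "\<And>t x. norm (f t x) \<le> C"
      "\<And>t x y. norm (f t x - f t y) \<le> L * norm (x - y)" "\<And>x. continuous_on UNIV (\<lambda>t. f t x)"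
    using bdd_lipE[OF assms(1)] by metis
  obtain D M where g: "\<And>t x. norm (g t x) \<le> D"
      "\<And>t x y. norm (g t x - g t y) \<le> M * norm (x - y)" "\<And>x. continuous_on UNIV (\<lambda>t. g t x)"
    using bdd_lipE[OF assms(2)] by metis
  show ?thesis
  proof (rule bdd_lipI)
    show "norm (f t x + g t x) \<le> C + D" for t x
      by (intro norm_triangle_mono f g)
    show "norm (f t x + g t x - (f t y + g t y)) \<le> (L + M) * norm (x - y)" for t x y
      unfolding add_diff_add distrib_right by (intro norm_triangle_mono f g)
    show "continuous_on UNIV (\<lambda>t. f t x + g t x)" for x
      by (intro continuous_intros f g)
  qed
qed

text \<open>Boundedness of both factors is what keeps the product globally Lipschitz.\<close>

lemma bdd_lip_scaleR:
  fixes f :: "real \<Rightarrow> 'a::real_normed_vector \<Rightarrow> real"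
  assumes "bdd_lip f" and "bdd_lip g"
  shows "bdd_lip (\<lambda>t x. f t x *\<^sub>R g t x)"
proof -
  obtain C L where f: "C \<ge> 0" "L \<ge> 0" "\<And>t x. norm (f t x) \<le> C"
      "\<And>t x y. norm (f t x - f t y) \<le> L * norm (x - y)" "\<And>x. continuous_on UNIV (\<lambda>t. f t x)"
    using bdd_lipE[OF assms(1)] by metis
  obtain D M where g: "D \<ge> 0" "M \<ge> 0" "\<And>t x. norm (g t x) \<le> D"
      "\<And>t x y. norm (g t x - g t y) \<le> M * norm (x - y)" "\<And>x. continuous_on UNIV (\<lambda>t. g t x)"
    using bdd_lipE[OF assms(2)] by metis
  show ?thesis
  proof (rule bdd_lipI)
    show "norm (f t x *\<^sub>R g t x) \<le> C * D" for t x
      unfolding norm_scaleR using f(1,3) g(3) by (intro mult_mono) auto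
    show "norm (f t x *\<^sub>R g t x - f t y *\<^sub>R g t y) \<le> (C * M + L * D) * norm (x - y)" for t x y
    proof -
      have "f t x *\<^sub>R g t x - f t y *\<^sub>R g t y = f t x *\<^sub>R (g t x - g t y) + (f t x - f t y) *\<^sub>R g t y"
        by (simp add: algebra_simps)
      also have "norm \<dots> \<le> C * (M * norm (x - y)) + (L * norm (x - y)) * D"
        unfolding norm_scaleR
        by (intro norm_triangle_mono; unfold norm_scaleR; intro mult_mono)
           (use f g in \<open>auto simp del: abs_mult\<close>)
      finally show ?thesis by (simp add: algebra_simps)
    qed
    show "continuous_on UNIV (\<lambda>t. f t x *\<^sub>R g t x)" for x
      by (intro continuous_intros f g)
  qed
qed

lemma bdd_lip_norm:
  assumes "bdd_lip f"
  shows "bdd_lip (\<lambda>t x. norm (f t x))"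
proof -
  obtain C L where f: "\<And>t x. norm (f t x) \<le> C"
      "\<And>t x y. norm (f t x - f t y) \<le> L * norm (x - y)" "\<And>x. continuous_on UNIV (\<lambda>t. f t x)"
    using bdd_lipE[OF assms] by metis
  show ?thesis
  proof (rule bdd_lipI)
    show "norm (norm (f t x) - norm (f t y)) \<le> L * norm (x - y)" for t x y
      using order_trans[OF norm_triangle_ineq3 f(2)] by simp
  qed (use f in \<open>auto intro: continuous_intros\<close>)
qed

lemma bdd_lip_compose:
  assumes "bdd_lip f" and p: "\<And>x y. norm (p x - p y) \<le> K * norm (x - y)"
  shows "bdd_lip (\<lambda>t x. f t (p x))"
proof -
  obtain C L where f: "L \<ge> 0" "\<And>t x. norm (f t x) \<le> C"
      "\<And>t x y. norm (f t x - f t y) \<le> L * norm (x - y)" "\<And>x. continuous_on UNIV (\<lambda>t. f t x)"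
    using bdd_lipE[OF assms(1)] by metis
  show ?thesis
  proof (rule bdd_lipI)
    show "norm (f t (p x) - f t (p y)) \<le> (L * K) * norm (x - y)" for t x y
      using order_trans[OF f(3) mult_left_mono[OF p f(1)]] by (simp add: mult.assoc)
  qed (use f in auto)
qed

lemma bdd_lip_time:
  assumes "continuous_on UNIV a" and "\<And>t. norm (a t) \<le> C"
  shows "bdd_lip (\<lambda>t x. a t)"
  by (rule bdd_lipI[of _ C 0]) (use assms in auto)

lemma bdd_lip_autonomous:
  assumes "\<And>x. norm (p x) \<le> C" and "\<And>x y. norm (p x - p y) \<le> K * norm (x - y)"
  shows "bdd_lip (\<lambda>t. p)"
  by (rule bdd_lipI[of _ C K]) (use assms in auto)

lemma bdd_lip_cmult: "bdd_lip f \<Longrightarrow> bdd_lip (\<lambda>t x. (k::real) *\<^sub>R f t x)"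
  by (rule bdd_lip_scaleR[OF bdd_lip_time[of "\<lambda>_. k" "\<bar>k\<bar>"]]) auto

text \<open>The linear part has the eigenvalues \<open>1\<close> and \<open>-(1 + c)\<close>, with eigencoordinates
  \<open>u = y + (1 + c) x\<close> and \<open>w = y - x\<close>.\<close>

lemma saddle_periodic_solution:
  fixes N\<^sub>1 N\<^sub>2 :: "real \<Rightarrow> 'a \<times> 'a \<Rightarrow> 'a::euclidean_space"
  assumes c: "c > 0" and T: "T > 0" and N\<^sub>1: "bdd_lip N\<^sub>1" and N\<^sub>2: "bdd_lip N\<^sub>2"
    and per\<^sub>1: "\<And>t z. N\<^sub>1 (t + T) z = N\<^sub>1 t z" and per\<^sub>2: "\<And>t z. N\<^sub>2 (t + T) z = N\<^sub>2 t z"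
  obtains x y where "\<And>t. (x has_vector_derivative y t + N\<^sub>1 t (x t, y t)) (at t)"
    and "\<And>t. (y has_vector_derivative - c *\<^sub>R y t + (1 + c) *\<^sub>R x t + N\<^sub>2 t (x t, y t)) (at t)"
    and "\<And>t. x (t + T) = x t" and "\<And>t. y (t + T) = y t"
proof -
  \<comment> \<open>The inverse of the passage to eigencoordinates:
    \<open>x = (u - w) / (2 + c)\<close> and \<open>y = (u + (1 + c) w) / (2 + c)\<close>.\<close>
  define Q :: "'a \<times> 'a \<Rightarrow> 'a \<times> 'a" where
    "Q z = ((1 / (2 + c)) *\<^sub>R (fst z - snd z), (1 / (2 + c)) *\<^sub>R (fst z + (1 + c) *\<^sub>R snd z))" for z
  have "bounded_linear Q"
    unfolding Q_def
    by (intro bounded_linear_Pair bounded_linear_const_scaleR bounded_linear_sub bounded_linear_add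
        bounded_linear_fst bounded_linear_snd)
  then interpret Q: bounded_linear Q .
  obtain K where "\<And>z. norm (Q z) \<le> norm z * K"
    using Q.bounded by blast
  then have K: "norm (Q x - Q y) \<le> K * norm (x - y)" for x y
    by (metis Q.diff mult.commute)
  \<comment> \<open>The perturbations of \<open>u' = y' + (1 + c) x'\<close> and
    \<open>w' = y' - x'\<close>. The factor \<open>- 1\<close> replaces a difference so that the
    closure rules for sums and multiples apply.\<close>
  define n\<^sub>1 where "n\<^sub>1 t z = N\<^sub>2 t (Q z) + (1 + c) *\<^sub>R N\<^sub>1 t (Q z)" for t z
  define n\<^sub>2 where "n\<^sub>2 t z = N\<^sub>2 t (Q z) + (- 1) *\<^sub>R N\<^sub>1 t (Q z)" for t z
  have "bdd_lip n\<^sub>1" "bdd_lip n\<^sub>2"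
    unfolding n\<^sub>1_def n\<^sub>2_def
    by (intro bdd_lip_add bdd_lip_cmult bdd_lip_compose[OF _ K] N\<^sub>1 N\<^sub>2)+
  obtain C\<^sub>1 L\<^sub>1 where 1: "\<And>t x. norm (n\<^sub>1 t x) \<le> C\<^sub>1"
      "\<And>t x y. norm (n\<^sub>1 t x - n\<^sub>1 t y) \<le> L\<^sub>1 * norm (x - y)" "\<And>x. continuous_on UNIV (\<lambda>t. n\<^sub>1 t x)"
    using bdd_lipE[OF \<open>bdd_lip n\<^sub>1\<close>] by metis
  obtain C\<^sub>2 L\<^sub>2 where 2: "\<And>t x. norm (n\<^sub>2 t x) \<le> C\<^sub>2"
      "\<And>t x y. norm (n\<^sub>2 t x - n\<^sub>2 t y) \<le> L\<^sub>2 * norm (x - y)" "\<And>x. continuous_on UNIV (\<lambda>t. n\<^sub>2 t x)"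
    using bdd_lipE[OF \<open>bdd_lip n\<^sub>2\<close>] by metis
  have max_L: "L\<^sub>1 * norm z \<le> max L\<^sub>1 L\<^sub>2 * norm z" "L\<^sub>2 * norm z \<le> max L\<^sub>1 L\<^sub>2 * norm z" for z :: "'a \<times> 'a"
    by (auto intro: mult_right_mono)
  obtain u w where u: "\<And>t. (u has_vector_derivative 1 *\<^sub>R u t + n\<^sub>1 t (u t, w t)) (at t)"
    and w: "\<And>t. (w has_vector_derivative (- (1 + c)) *\<^sub>R w t + n\<^sub>2 t (u t, w t)) (at t)"
    and uw: "\<And>t. u (t + T) = u t" "\<And>t. w (t + T) = w t"
  proof (rule hyperbolic_periodic_solution[of 1 "- (1 + c)" T n\<^sub>1 "max L\<^sub>1 L\<^sub>2" n\<^sub>2 "max C\<^sub>1 C\<^sub>2"])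
    show "norm (n\<^sub>1 t x) \<le> max C\<^sub>1 C\<^sub>2" "norm (n\<^sub>2 t x) \<le> max C\<^sub>1 C\<^sub>2" for t x
      using 1(1)[of t x] 2(1)[of t x] by auto
    show "norm (n\<^sub>1 t x - n\<^sub>1 t y) \<le> max L\<^sub>1 L\<^sub>2 * norm (x - y)"
         "norm (n\<^sub>2 t x - n\<^sub>2 t y) \<le> max L\<^sub>1 L\<^sub>2 * norm (x - y)" for t x y
      using order_trans[OF 1(2) max_L(1)] order_trans[OF 2(2) max_L(2)] by auto
    show "n\<^sub>1 (t + T) x = n\<^sub>1 t x" "n\<^sub>2 (t + T) x = n\<^sub>2 t x" for t x
      by (simp_all add: n\<^sub>1_def n\<^sub>2_def per\<^sub>1 per\<^sub>2)
  qed (use 1 2 c T in auto)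
  define x where "x t = fst (Q (u t, w t))" for t
  define y where "y t = snd (Q (u t, w t))" for t
  define u' where "u' t = u t + n\<^sub>1 t (u t, w t)" for t
  define w' where "w' t = (- (1 + c)) *\<^sub>R w t + n\<^sub>2 t (u t, w t)" for t
  have xy: "Q (u t, w t) = (x t, y t)" for t
    by (simp add: x_def y_def)
  have Q': "((\<lambda>t. Q (u t, w t)) has_vector_derivative Q (u' t, w' t)) (at t)" for t
    unfolding u'_def w'_def
    using u w by (intro Q.has_vector_derivative has_vector_derivative_Pair) simp_all
  have c2: "2 + c \<noteq> 0" using c by simp
  have u_xy: "u t = y t + (1 + c) *\<^sub>R x t" and w_xy: "w t = y t - x t" for t
  proof -
    have "(2 + c) *\<^sub>R (y t + (1 + c) *\<^sub>R x t) = (2 + c) *\<^sub>R u t"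
      using c2 by (simp add: x_def y_def Q_def scaleR_add_right) (simp add: algebra_simps scaleR_2)
    then show "u t = y t + (1 + c) *\<^sub>R x t" using c2 by simp
    have "(2 + c) *\<^sub>R (y t - x t) = (2 + c) *\<^sub>R w t"
      using c2 by (simp add: x_def y_def Q_def scaleR_diff_right) (simp add: algebra_simps scaleR_2)
    then show "w t = y t - x t" using c2 by simp
  qed
  have "fst (Q (u' t, w' t)) = y t + N\<^sub>1 t (x t, y t)" for t
  proof -
    have "u' t - w' t = (2 + c) *\<^sub>R (y t + N\<^sub>1 t (x t, y t))"
      by (simp add: u'_def w'_def n\<^sub>1_def n\<^sub>2_def xy) (simp add: u_xy w_xy algebra_simps scaleR_2 mult_2_right)
    then show ?thesis using c2 by (simp add: Q_def)
  qed
  moreover have "snd (Q (u' t, w' t)) = - c *\<^sub>R y t + (1 + c) *\<^sub>R x t + N\<^sub>2 t (x t, y t)" for t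
  proof -
    have "u' t + (1 + c) *\<^sub>R w' t = (2 + c) *\<^sub>R (- c *\<^sub>R y t + (1 + c) *\<^sub>R x t + N\<^sub>2 t (x t, y t))"
      (is "?l = ?r")
    proof (rule euclidean_eqI)
      show "?l \<bullet> b = ?r \<bullet> b" for b
        unfolding u'_def w'_def n\<^sub>1_def n\<^sub>2_def xy
        unfolding u_xy w_xy inner_simps by algebra
    qed
    then show ?thesis using c2 by (simp add: Q_def)
  qed
  ultimately show thesis
    using bounded_linear.has_vector_derivative[OF bounded_linear_fst Q']
      bounded_linear.has_vector_derivative[OF bounded_linear_snd Q'] uw
    by (intro that[of x y]) (simp_all add: x_def[abs_def] y_def[abs_def])
qed

text \<open>The projection onto a ball is used because it is nonexpansive; this formula shows that
  it is also radial. At \<open>x = 0\<close> the quotient is \<open>0\<close> by convention, which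
  is harmless since the factor multiplies \<open>0\<close>.\<close>

lemma closest_point_cball_0:
  fixes x :: "'a::euclidean_space"
  assumes "r > 0"
  shows "closest_point (cball 0 r) x = min 1 (r / norm x) *\<^sub>R x"
proof (cases "norm x \<le> r")
  case True
  then show ?thesis
    by (cases "x = 0") (auto simp: closest_point_self min_def field_simps)
next
  case False
  then have x: "norm x > r" "norm x > 0" using assms by auto
  have "(r / norm x) *\<^sub>R x = closest_point (cball 0 r) x"
  proof (rule closest_point_unique)
    show "\<forall>z\<in>cball 0 r. dist x ((r / norm x) *\<^sub>R x) \<le> dist x z"
    proof
      fix z :: 'a assume "z \<in> cball 0 r"
      then have "norm x - r \<le> dist x z"
        using norm_triangle_ineq2[of x z] by (simp add: dist_norm)
      moreover have "x - (r / norm x) *\<^sub>R x = (1 - r / norm x) *\<^sub>R x"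
        by (simp add: algebra_simps)
      then have "dist x ((r / norm x) *\<^sub>R x) = (1 - r / norm x) * norm x"
        using x by (simp add: dist_norm)
      ultimately show "dist x ((r / norm x) *\<^sub>R x) \<le> dist x z"
        using x by (simp add: algebra_simps)
    qed
  qed (use x assms in auto)
  then show ?thesis
    using x by (simp add: min_def)
qed

lemma periodic_attains_max:
  fixes u :: "real \<Rightarrow> real"
  assumes "continuous_on UNIV u" and T: "T > 0" and per: "\<And>t. u (t + T) = u t"
  obtains t\<^sub>0 where "\<And>t. u t \<le> u t\<^sub>0"
proof -
  interpret periodic_fun_simple u T
    by standard (rule per)
  obtain t\<^sub>0 where t\<^sub>0: "\<forall>t\<in>{0..T}. u t \<le> u t\<^sub>0"
    using continuous_attains_sup[of "{0..T}" u] assms(1) T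
    by (auto intro: continuous_on_subset)
  have "u t \<le> u t\<^sub>0" for t
  proof -
    \<comment> \<open>Subtracting a whole number of periods brings \<open>t\<close> into the compact
      interval on which the maximum was taken.\<close>
    have "t - of_int \<lfloor>t / T\<rfloor> * T \<in> {0..T}"
      using T floor_divide_lower[OF T, of t] floor_divide_upper[OF T, of t]
      by (auto simp: algebra_simps)
    then show ?thesis
      using t\<^sub>0 minus_of_int[of t "\<lfloor>t / T\<rfloor>"] by metis
  qed
  then show thesis by (rule that)
qed

section \<open>The pendulum in gnomonic coordinates\<close>

text \<open>The right-hand side is truncated with the projections \<open>P\<close>, \<open>S\<close> onto balls, which turns the
  system into a bounded perturbation of a saddle. Since \<open>P\<close> and \<open>S\<close> are radial, \<open>x \<bullet> x'\<close> keeps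
  the sign of \<open>x \<bullet> y\<close>, so that the truncation is never active along a periodic solution: at a
  maximum of \<open>norm x\<close> outside the ball \<open>x \<bullet> y\<close> would vanish with positive derivative.\<close>

lemma gnomonic_periodic_solution:
  fixes a :: "real \<Rightarrow> 'a::euclidean_space"
  assumes a: "continuous_on UNIV a" and aT: "\<And>t. a (t + T) = a t"
    and T: "T > 0" and g: "g > 0" and c: "c > 0"
  obtains x y where
    "\<And>t. (x has_vector_derivative (1 + (norm (x t))\<^sup>2) *\<^sub>R y t) (at t)"
    and "\<And>t. (y has_vector_derivative
           - c *\<^sub>R y t + (1 / sqrt (1 + (norm (x t))\<^sup>2)) *\<^sub>R (g *\<^sub>R x t - a t)) (at t)"
    and "\<And>t. x (t + T) = x t"
proof -
  obtain t\<^sub>a where t\<^sub>a: "\<And>t. norm (a t) \<le> norm (a t\<^sub>a)"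
    by (rule periodic_attains_max[of "\<lambda>t. norm (a t)" T])
       (use a aT T in \<open>auto intro: continuous_intros\<close>)
  define A where "A = norm (a t\<^sub>a)"
  have A: "norm (a t) \<le> A" "A \<ge> 0" for t
    using t\<^sub>a by (auto simp: A_def)
  \<comment> \<open>Chosen so that \<open>g * R > A\<close>: on and outside the sphere of radius
    \<open>R\<close> gravity outweighs the acceleration of the pivot.\<close>
  define R where "R = A / g + 1"
  have R: "R > 0" "g * R > A"
    using A g by (auto simp: R_def field_simps add_nonneg_pos)
  \<comment> \<open>The bound that friction gives for \<open>y\<close>, because the forcing is at
    most \<open>g * R + A\<close> while \<open>norm x \<le> R\<close>.\<close>
  define Y where "Y = (g * R + A) / c"
  have Y: "Y > 0" using R A(2) g c by (simp add: Y_def add_pos_nonneg)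
  define P :: "'a \<Rightarrow> 'a" where "P = closest_point (cball 0 R)"
  define S :: "'a \<Rightarrow> 'a" where "S = closest_point (cball 0 Y)"
  have bound: "norm (P x) \<le> R" "norm (S x) \<le> Y" for x
    using closest_point_in_set[of "cball 0 R" x] closest_point_in_set[of "cball 0 Y" x] R Y
    by (auto simp: P_def S_def)
  have lip: "norm (P x - P y) \<le> 1 * norm (x - y)" "norm (S x - S y) \<le> 1 * norm (x - y)" for x y
    using closest_point_lipschitz[of "cball 0 R" x y] closest_point_lipschitz[of "cball 0 Y" x y] R Y
    by (auto simp: P_def S_def dist_norm)
  have P_lip: "bdd_lip (\<lambda>t (z :: 'a \<times> 'a). P (fst z))" and S_lip: "bdd_lip (\<lambda>t (z :: 'a \<times> 'a). S (snd z))"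
  proof -
    have "norm (fst x - fst y) \<le> 1 * norm (x - y)" "norm (snd x - snd y) \<le> 1 * norm (x - y)"
      for x y :: "'a \<times> 'a"
      using norm_fst_le[of "fst (x - y)" "snd (x - y)"] norm_snd_le[of "snd (x - y)" "fst (x - y)"]
      unfolding prod.collapse by simp_all
    then show "bdd_lip (\<lambda>t (z :: 'a \<times> 'a). P (fst z))" "bdd_lip (\<lambda>t (z :: 'a \<times> 'a). S (snd z))"
      using bdd_lip_compose[OF bdd_lip_autonomous[of P, OF bound(1) lip(1)], of fst 1]
        bdd_lip_compose[OF bdd_lip_autonomous[of S, OF bound(2) lip(2)], of snd 1] by auto
  qed
  have norm_lip: "bdd_lip (\<lambda>t (z :: 'a \<times> 'a). norm (P (fst z)))"
    by (rule bdd_lip_norm[OF P_lip])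
  \<comment> \<open>As the norm of \<open>(1, v)\<close>, \<sigma> is 1-Lipschitz by the reverse
    triangle inequality; being at least 1, it has a 1-Lipschitz reciprocal too.\<close>
  define \<sigma> where "\<sigma> v = sqrt (1 + (norm v)\<^sup>2)" for v :: 'a
  have \<sigma>1: "\<sigma> v \<ge> 1" for v
    by (simp add: \<sigma>_def)
  have \<sigma>_lip: "\<bar>\<sigma> v - \<sigma> w\<bar> \<le> norm (v - w)" for v w
    using norm_triangle_ineq3[of "(1::real, v)" "(1::real, w)"] by (simp add: \<sigma>_def norm_Pair)
  have inv_lip: "bdd_lip (\<lambda>t (z :: 'a \<times> 'a). 1 / \<sigma> (P (fst z)))"
  proof -
    have "\<bar>1 / \<sigma> v - 1 / \<sigma> w\<bar> \<le> 1 * norm (v - w)" for v w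
    proof -
      have "1 / \<sigma> v - 1 / \<sigma> w = (\<sigma> w - \<sigma> v) / (\<sigma> v * \<sigma> w)"
        using \<sigma>1[of v] \<sigma>1[of w] by (simp add: field_simps)
      then have "\<bar>1 / \<sigma> v - 1 / \<sigma> w\<bar> = \<bar>\<sigma> v - \<sigma> w\<bar> / (\<sigma> v * \<sigma> w)"
        using \<sigma>1[of v] \<sigma>1[of w] by (simp add: abs_mult)
      also have "\<dots> \<le> \<bar>\<sigma> v - \<sigma> w\<bar> / 1"
        using \<sigma>1[of v] \<sigma>1[of w] mult_mono[of 1 "\<sigma> v" 1 "\<sigma> w"] by (intro divide_left_mono) auto
      finally show ?thesis using \<sigma>_lip[of v w] by simp
    qed
    moreover have "\<bar>1 / \<sigma> v\<bar> \<le> 1" for v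
      using \<sigma>1[of v] by simp
    ultimately have "bdd_lip (\<lambda>t v. 1 / \<sigma> v)"
      by (intro bdd_lip_autonomous[of _ 1 1]) auto
    moreover obtain L where "\<And>z w :: 'a \<times> 'a. norm (P (fst z) - P (fst w)) \<le> L * norm (z - w)"
      using bdd_lipE[OF P_lip] by metis
    ultimately show ?thesis
      by (rule bdd_lip_compose)
  qed
  define h where "h t v = (1 / \<sigma> v) *\<^sub>R (g *\<^sub>R v - a t)" for t v
  \<comment> \<open>\<open>N\<^sub>1\<close> truncates the product of the squared norm of
    \<open>x\<close> with \<open>y\<close>, written as repeated scaling to match the product rule.
    In \<open>N\<^sub>2\<close> the first summand cancels, inside the ball, the term
    \<open>(1 + c) x\<close> of the artificial saddle.\<close>
  define N\<^sub>1 where "N\<^sub>1 t z = norm (P (fst z)) *\<^sub>R norm (P (fst z)) *\<^sub>R S (snd z)" 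
    for t :: real and z :: "'a \<times> 'a"
  define N\<^sub>2 where "N\<^sub>2 t z = - (1 + c) *\<^sub>R P (fst z) + h t (P (fst z))" for t and z :: "'a \<times> 'a"
  have "bdd_lip N\<^sub>1"
    unfolding N\<^sub>1_def by (intro bdd_lip_scaleR norm_lip S_lip)
  moreover have "bdd_lip (\<lambda>t (z :: 'a \<times> 'a). - a t)"
    by (rule bdd_lip_time[of _ A]) (use a A in \<open>auto intro: continuous_intros\<close>)
  then have "bdd_lip N\<^sub>2"
    unfolding N\<^sub>2_def h_def diff_conv_add_uminus
    by (intro bdd_lip_scaleR bdd_lip_add bdd_lip_cmult inv_lip P_lip)
  ultimately obtain x y where
        x': "\<And>t. (x has_vector_derivative y t + N\<^sub>1 t (x t, y t)) (at t)"
    and y': "\<And>t. (y has_vector_derivative - c *\<^sub>R y t + (1 + c) *\<^sub>R x t + N\<^sub>2 t (x t, y t)) (at t)"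
    and xT: "\<And>t. x (t + T) = x t" and yT: "\<And>t. y (t + T) = y t"
    by (rule saddle_periodic_solution[OF c T])
       (auto simp: N\<^sub>1_def N\<^sub>2_def h_def aT)
  have xc: "continuous_on UNIV x" and yc: "continuous_on UNIV y"
    using x' y' by (meson continuous_at_imp_continuous_on has_vector_derivative_continuous)+

  define q where "q t = x t \<bullet> y t" for t
  \<comment> \<open>Radiality of \<open>S\<close> makes \<open>x'\<close> the multiple
    \<open>1 + \<tau>\<close> of \<open>y\<close>. For \<open>y t = 0\<close> the quotient is
    \<open>0\<close>, and both sides of the identity for \<open>N\<^sub>1\<close> vanish.\<close>
  define \<tau> where "\<tau> t = (norm (P (x t)))\<^sup>2 * min 1 (Y / norm (y t))" for t
  have \<tau>: "\<tau> t \<ge> 0" for t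
    using Y by (simp add: \<tau>_def)
  have N\<^sub>1: "N\<^sub>1 t (x t, y t) = \<tau> t *\<^sub>R y t" for t
    using closest_point_cball_0[OF Y, of "y t"] by (simp add: N\<^sub>1_def \<tau>_def S_def power2_eq_square)
  have x'': "(x has_vector_derivative (1 + \<tau> t) *\<^sub>R y t) (at t)" for t
    using x'[of t] by (simp add: N\<^sub>1 algebra_simps)
  have u': "((\<lambda>t. x t \<bullet> x t) has_real_derivative 2 * (1 + \<tau> t) * q t) (at t)" for t
    using has_real_derivative_inner[OF x'' x'', of t]
    by (simp add: q_def inner_commute algebra_simps)
  have q': "(q has_real_derivative (1 + \<tau> t) * (y t \<bullet> y t) +
      (x t \<bullet> (- c *\<^sub>R y t + (1 + c) *\<^sub>R x t + N\<^sub>2 t (x t, y t)))) (at t)" for t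
    using has_real_derivative_inner[OF x'' y', of t] unfolding q_def by simp

  obtain t\<^sub>0 where t\<^sub>0: "\<And>t. x t \<bullet> x t \<le> x t\<^sub>0 \<bullet> x t\<^sub>0"
    by (rule periodic_attains_max[of "\<lambda>t. x t \<bullet> x t" T])
       (use xc xT T in \<open>auto intro: continuous_intros\<close>)
  have "norm (x t\<^sub>0) \<le> R"
  proof (rule ccontr)
    let ?x = "x t\<^sub>0"
    assume "\<not> norm ?x \<le> R"
    then have xR: "norm ?x > R" "norm ?x > 0" using R by auto
    have "2 * (1 + \<tau> t\<^sub>0) * q t\<^sub>0 = 0"
      by (rule DERIV_local_max[OF u', of 1]) (use t\<^sub>0 in auto)
    then have q0: "q t\<^sub>0 = 0" using \<tau>[of t\<^sub>0] by simp
    have P: "P ?x = (R / norm ?x) *\<^sub>R ?x"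
      using closest_point_cball_0[OF R(1), of ?x] xR by (simp add: P_def min_def)
    have "?x \<bullet> a t\<^sub>0 \<le> norm ?x * A"
      using norm_cauchy_schwarz[of ?x "a t\<^sub>0"] mult_left_mono[OF A(1) norm_ge_zero, of ?x t\<^sub>0] by linarith
    also have "\<dots> < norm ?x * (g * R)"
      using R xR by simp
    also have "\<dots> = ?x \<bullet> (g *\<^sub>R P ?x)"
      using xR by (simp add: P dot_square_norm power2_eq_square)
    finally have "?x \<bullet> (g *\<^sub>R P ?x - a t\<^sub>0) > 0"
      by (simp add: inner_diff_right)
    then have h0: "?x \<bullet> h t\<^sub>0 (P ?x) > 0"
      using \<sigma>1[of "P ?x"] by (simp add: h_def)
    \<comment> \<open>The part of the saddle term that the truncation leaves uncancelled also points
      outwards, so it helps gravity.\<close>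
    have "?x \<bullet> ?x - ?x \<bullet> P ?x = norm ?x * (norm ?x - R)"
      using xR by (simp add: P dot_square_norm power2_eq_square algebra_simps)
    then have pen: "?x \<bullet> ?x - ?x \<bullet> P ?x \<ge> 0"
      using xR by simp
    have "?x \<bullet> (- c *\<^sub>R y t\<^sub>0 + (1 + c) *\<^sub>R ?x + N\<^sub>2 t\<^sub>0 (?x, y t\<^sub>0))
        = - c * q t\<^sub>0 + (1 + c) * (?x \<bullet> ?x - ?x \<bullet> P ?x) + ?x \<bullet> h t\<^sub>0 (P ?x)"
      by (simp add: N\<^sub>2_def q_def algebra_simps)
    also have "\<dots> > 0"
      using q0 pen h0 c by (simp add: add_nonneg_pos)
    finally have "(1 + \<tau> t\<^sub>0) * (y t\<^sub>0 \<bullet> y t\<^sub>0) +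
        ?x \<bullet> (- c *\<^sub>R y t\<^sub>0 + (1 + c) *\<^sub>R ?x + N\<^sub>2 t\<^sub>0 (?x, y t\<^sub>0)) > 0"
      using \<tau>[of t\<^sub>0] by (simp add: add_nonneg_pos)
    from DERIV_pos_inc_right[OF q' this]
    obtain d where d: "d > 0" and qd: "\<And>e. 0 < e \<Longrightarrow> e < d \<Longrightarrow> q t\<^sub>0 < q (t\<^sub>0 + e)"
      by blast
    \<comment> \<open>Since \<open>q\<close> vanishes at \<open>t\<^sub>0\<close> with positive
      derivative, it is positive just afterwards. Then \<open>x \<bullet> x\<close>, whose
      derivative has the sign of \<open>q\<close>, rises above its maximum.\<close>
    have q_pos: "q t > 0" if "t\<^sub>0 < t" "t < t\<^sub>0 + d / 2" for t
      using qd[of "t - t\<^sub>0"] that q0 d by simp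
    have "x t\<^sub>0 \<bullet> x t\<^sub>0 < x (t\<^sub>0 + d / 2) \<bullet> x (t\<^sub>0 + d / 2)"
    proof (rule DERIV_pos_imp_increasing_open[of t\<^sub>0 "t\<^sub>0 + d / 2" "\<lambda>t. x t \<bullet> x t"])
      show "\<exists>z. ((\<lambda>t. x t \<bullet> x t) has_real_derivative z) (at t) \<and> z > 0"
        if "t\<^sub>0 < t" "t < t\<^sub>0 + d / 2" for t
        using u'[of t] q_pos[OF that] \<tau>[of t] by (auto intro!: exI mult_pos_pos)
      show "continuous_on {t\<^sub>0..t\<^sub>0 + d / 2} (\<lambda>t. x t \<bullet> x t)"
        using xc by (auto intro!: continuous_intros intro: continuous_on_subset)
    qed (use d in simp)
    with t\<^sub>0[of "t\<^sub>0 + d / 2"] show False by simp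
  qed
  moreover have "norm (x t) \<le> norm (x t\<^sub>0)" for t
    using t\<^sub>0[of t] by (simp add: norm_le)
  ultimately have xR: "norm (x t) \<le> R" for t
    using order_trans by blast
  then have Px: "P (x t) = x t" for t
    by (simp add: P_def closest_point_self)
  have y'': "(y has_vector_derivative - c *\<^sub>R y t + h t (x t)) (at t)" for t
    using y'[of t] by (simp add: N\<^sub>2_def Px algebra_simps)

  obtain t\<^sub>1 where t\<^sub>1: "\<And>t. y t \<bullet> y t \<le> y t\<^sub>1 \<bullet> y t\<^sub>1"
    by (rule periodic_attains_max[of "\<lambda>t. y t \<bullet> y t" T])
       (use yc yT T in \<open>auto intro: continuous_intros\<close>)
  have "norm (y t\<^sub>1) \<le> Y"
  proof -
    let ?y = "y t\<^sub>1"
    \<comment> \<open>At a maximum of \<open>y \<bullet> y\<close> friction balances the forcing, so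
      \<open>c\<close> times the squared norm of \<open>y\<close> equals
      \<open>y \<bullet> h\<close>, and Cauchy-Schwarz yields the bound \<open>Y\<close>.\<close>
    have "(- c *\<^sub>R ?y + h t\<^sub>1 (x t\<^sub>1)) \<bullet> ?y + ?y \<bullet> (- c *\<^sub>R ?y + h t\<^sub>1 (x t\<^sub>1)) = 0"
      by (rule DERIV_local_max[OF has_real_derivative_inner[OF y'' y''], of 1]) (use t\<^sub>1 in auto)
    then have "?y \<bullet> (- c *\<^sub>R ?y + h t\<^sub>1 (x t\<^sub>1)) = 0"
      by (simp only: inner_commute[of _ ?y])
    then have ch: "c * (norm ?y)\<^sup>2 = ?y \<bullet> h t\<^sub>1 (x t\<^sub>1)"
      by (simp add: dot_square_norm inner_diff_right)
    have "norm (h t\<^sub>1 (x t\<^sub>1)) \<le> 1 * (g * R + A)"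
      unfolding h_def norm_scaleR
    proof (rule mult_mono)
      show "\<bar>1 / \<sigma> (x t\<^sub>1)\<bar> \<le> 1" using \<sigma>1[of "x t\<^sub>1"] by simp
      have "norm (g *\<^sub>R x t\<^sub>1 - a t\<^sub>1) \<le> norm (g *\<^sub>R x t\<^sub>1) + norm (a t\<^sub>1)"
        by (rule norm_triangle_ineq4)
      also have "\<dots> \<le> g * R + A"
        using g xR[of t\<^sub>1] A(1)[of t\<^sub>1] by (simp add: add_mono)
      finally show "norm (g *\<^sub>R x t\<^sub>1 - a t\<^sub>1) \<le> g * R + A" .
    qed auto
    then have "norm ?y * norm (h t\<^sub>1 (x t\<^sub>1)) \<le> norm ?y * (g * R + A)"
      by (intro mult_left_mono) auto
    with norm_cauchy_schwarz[of ?y "h t\<^sub>1 (x t\<^sub>1)"]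
    have "c * (norm ?y)\<^sup>2 \<le> norm ?y * (g * R + A)"
      unfolding ch by linarith
    then have yy: "norm ?y * (c * norm ?y) \<le> norm ?y * (g * R + A)"
      by (simp add: power2_eq_square ac_simps)
    have "norm ?y = 0 \<or> c * norm ?y \<le> g * R + A"
    proof (cases "norm ?y > 0")
      case True
      then show ?thesis using mult_left_le_imp_le[OF yy] by blast
    qed simp
    then show ?thesis
    proof
      assume "norm ?y = 0"
      then show ?thesis using Y by simp
    next
      assume "c * norm ?y \<le> g * R + A"
      then show ?thesis using c by (simp add: Y_def pos_le_divide_eq mult.commute)
    qed
  qed
  moreover have "norm (y t) \<le> norm (y t\<^sub>1)" for t
    using t\<^sub>1[of t] by (simp add: norm_le)
  ultimately have "norm (y t) \<le> Y" for t
    using order_trans by blast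
  then have "S (y t) = y t" for t
    by (simp add: S_def closest_point_self)
  then have "(x has_vector_derivative (1 + (norm (x t))\<^sup>2) *\<^sub>R y t) (at t)" for t
    using x'[of t] by (simp add: N\<^sub>1_def Px algebra_simps power2_eq_square)
  then show thesis
    using y'' xT by (intro that[of x y]) (simp_all add: h_def \<sigma>_def)
qed

section \<open>The pivot acceleration and the return to the sphere\<close>

lemma smooth_deriv:
  assumes "smooth f"
  shows "(f has_real_derivative deriv f t) (at t)"
    and "(deriv f has_real_derivative deriv (deriv f) t) (at t)"
    and "continuous_on UNIV (deriv (deriv f))"
proof -
  have d: "(deriv ^^ n) f differentiable at t" for n t
    using assms by (simp add: smooth_def)
  show "(f has_real_derivative deriv f t) (at t)"
    using d[of 0 t] by (simp add: DERIV_deriv_iff_real_differentiable)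
  show "(deriv f has_real_derivative deriv (deriv f) t) (at t)"
    using d[of 1 t] by (simp add: DERIV_deriv_iff_real_differentiable)
  show "continuous_on UNIV (deriv (deriv f))"
    using d[of 2] by (auto simp: numeral_2_eq_2 intro!: continuous_at_imp_continuous_on
        differentiable_imp_continuous_within)
qed

lemma deriv_periodic:
  fixes f :: "real \<Rightarrow> real"
  assumes "\<And>t. f (t + T) = f t"
  shows "deriv f (t + T) = deriv f t"
  unfolding deriv_def DERIV_shift by (simp add: assms)

lemma curve_deriv_eqI:
  assumes "\<And>t. (f has_vector_derivative f' t) (at t)"
  shows "curve_deriv f = f'"
  using assms by (auto simp: curve_deriv_def fun_eq_iff vector_derivative_at)

text \<open>The type \<open>complex\<close> stands for the horizontal plane as a two-dimensional
  Euclidean space.\<close>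

definition horizontal :: "complex \<Rightarrow> real ^ 3" where
  "horizontal p = Re p *\<^sub>R e_x + Im p *\<^sub>R e_y"

lemma bounded_linear_horizontal: "bounded_linear horizontal"
  unfolding horizontal_def
  by (intro bounded_linear_add bounded_linear_scaleR_const bounded_linear_Re bounded_linear_Im)

lemma inner_horizontal_e_z [simp]: "horizontal p \<bullet> e_z = 0" "e_z \<bullet> horizontal p = 0"
  by (simp_all add: horizontal_def e_x_def e_y_def e_z_def inner_axis_axis algebra_simps)

lemma inner_horizontal [simp]: "horizontal p \<bullet> horizontal q = p \<bullet> q"
  by (simp add: horizontal_def e_x_def e_y_def inner_axis_axis inner_complex_def algebra_simps)

lemma inner_e_z [simp]: "e_z \<bullet> e_z = 1"
  by (simp add: e_z_def inner_axis_axis)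

lemma curve_deriv_pivot:
  assumes "smooth \<xi>" and "smooth \<eta>"
  shows "curve_deriv (curve_deriv (pivot \<xi> \<eta>)) t
    = horizontal (Complex (deriv (deriv \<xi>) t) (deriv (deriv \<eta>) t))"
proof -
  have pivot': "((\<lambda>t. f t *\<^sub>R e_x + h t *\<^sub>R e_y) has_vector_derivative f' *\<^sub>R e_x + h' *\<^sub>R e_y) (at t)"
    if "(f has_real_derivative f') (at t)" "(h has_real_derivative h') (at t)" for f h f' h' t
    using has_vector_derivative_add[OF
        has_vector_derivative_scaleR[OF that(1) has_vector_derivative_const]
        has_vector_derivative_scaleR[OF that(2) has_vector_derivative_const]] by simp
  have "curve_deriv (pivot \<xi> \<eta>) = (\<lambda>t. deriv \<xi> t *\<^sub>R e_x + deriv \<eta> t *\<^sub>R e_y)"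
    unfolding pivot_def[abs_def] by (intro curve_deriv_eqI pivot' smooth_deriv assms)
  moreover have "curve_deriv (\<lambda>t. deriv \<xi> t *\<^sub>R e_x + deriv \<eta> t *\<^sub>R e_y)
      = (\<lambda>t. deriv (deriv \<xi>) t *\<^sub>R e_x + deriv (deriv \<eta>) t *\<^sub>R e_y)"
    by (intro curve_deriv_eqI pivot' smooth_deriv assms)
  ultimately show ?thesis
    by (simp add: horizontal_def)
qed

text \<open>The inverse of the gnomonic chart: the tangent plane at the north pole is projected from
  the centre onto the open upper hemisphere. Any curve in the plane thus gives a motion that stays
  above the horizon.\<close>

definition gnomonic :: "complex \<Rightarrow> real ^ 3" where
  "gnomonic p = (1 / sqrt (1 + (norm p)\<^sup>2)) *\<^sub>R (horizontal p + e_z)"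

lemma gnomonic_S2: "gnomonic p \<in> S2"
proof -
  have "(horizontal p + e_z) \<bullet> (horizontal p + e_z) = 1 + p \<bullet> p"
    by (simp add: inner_add_left inner_add_right)
  then have "norm (horizontal p + e_z) = sqrt (1 + (norm p)\<^sup>2)"
    unfolding norm_eq_sqrt_inner[of "horizontal p + e_z"] power2_norm_eq_inner by (rule arg_cong)
  moreover have "sqrt (1 + (norm p)\<^sup>2) > 0"
    by (simp add: add_pos_nonneg)
  ultimately show ?thesis
    by (simp add: gnomonic_def del: scaleR_add_right)
qed

lemma gnomonic_upper: "gnomonic p \<bullet> e_z > 0"
  by (simp add: gnomonic_def inner_add_left add_pos_nonneg)

text \<open>Two differentiations of the lifted curve give a combination of \<open>r\<close>, its
  velocity, \<open>e_z\<close> and the pivot acceleration. The coefficient of \<open>r\<close> is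
  free, because the constraint force absorbs it.\<close>

lemma gnomonic_pendulum_solution:
  fixes x y a :: "real \<Rightarrow> complex"
  assumes m: "m > 0"
    and x: "\<And>t. (x has_vector_derivative (1 + (norm (x t))\<^sup>2) *\<^sub>R y t) (at t)"
    and y: "\<And>t. (y has_vector_derivative - (\<gamma> / m) *\<^sub>R y t +
          (1 / sqrt (1 + (norm (x t))\<^sup>2)) *\<^sub>R (g *\<^sub>R x t - a t)) (at t)"
    and \<rho>: "\<And>t. curve_deriv (curve_deriv \<rho>) t = horizontal (a t)"
  shows "\<exists>r0 \<in> S2. \<exists>v0 \<in> tangent_S2 r0. pendulum_solution m g \<gamma> \<rho> r0 v0 (\<lambda>t. gnomonic (x t))"
proof -
  interpret J: bounded_linear horizontal
    by (rule bounded_linear_horizontal)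
  define s where "s t = sqrt (1 + (norm (x t))\<^sup>2)" for t
  \<comment> \<open>\<beta> is the logarithmic derivative of \<open>s\<close>, since
    \<open>x' = s * s * y\<close>.\<close>
  define \<beta> where "\<beta> t = x t \<bullet> y t" for t
  define c where "c = \<gamma> / m"
  define y' where "y' t = - c *\<^sub>R y t + (1 / s t) *\<^sub>R (g *\<^sub>R x t - a t)" for t
  define r where "r t = gnomonic (x t)" for t
  define v where "v t = - \<beta> t *\<^sub>R r t + s t *\<^sub>R horizontal (y t)" for t
  have s_pos: "s t > 0" for t
    by (simp add: s_def add_pos_nonneg)
  have s2: "1 + (norm (x t))\<^sup>2 = s t * s t" for t
    by (simp add: s_def add_nonneg_nonneg)
  have x': "(x has_vector_derivative (s t * s t) *\<^sub>R y t) (at t)" for t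
    using x[of t] by (simp add: s2)
  have y': "(y has_vector_derivative y' t) (at t)" for t
    using y[of t] by (simp add: y'_def c_def s_def)
  have s': "(s has_real_derivative \<beta> t * s t) (at t)" for t
  proof -
    have "((\<lambda>t. 1 + x t \<bullet> x t) has_real_derivative 2 * (s t * s t) * \<beta> t) (at t)"
      using DERIV_add[OF DERIV_const has_real_derivative_inner[OF x' x'], of 1 t]
      by (simp add: \<beta>_def inner_commute algebra_simps)
    moreover have "s = (\<lambda>t. sqrt (1 + x t \<bullet> x t))"
      by (simp add: s_def fun_eq_iff dot_square_norm)
    ultimately have "(s has_real_derivative inverse (s t) / 2 * (2 * (s t * s t) * \<beta> t)) (at t)"
      using DERIV_chain2[OF DERIV_real_sqrt, of "\<lambda>t. 1 + x t \<bullet> x t" t] s_pos[of t]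
      by (simp add: real_sqrt_gt_0_iff)
    then show ?thesis
      by (rule DERIV_cong) (use s_pos[of t] in simp)
  qed
  have r_eq: "r t = (1 / s t) *\<^sub>R (horizontal (x t) + e_z)" for t
    by (simp add: r_def gnomonic_def s_def)
  have r': "(r has_vector_derivative v t) (at t)" for t
  proof -
    have "((\<lambda>t. 1 / s t) has_real_derivative - \<beta> t / s t) (at t)"
      using s_pos[of t] by (auto intro!: derivative_eq_intros s' simp: field_simps)
    moreover have "((\<lambda>t. horizontal (x t) + e_z) has_vector_derivative
        horizontal ((s t * s t) *\<^sub>R y t) + 0) (at t)"
      by (intro has_vector_derivative_add has_vector_derivative_const J.has_vector_derivative x')
    ultimately have "((\<lambda>t. (1 / s t) *\<^sub>R (horizontal (x t) + e_z)) has_vector_derivative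
        (1 / s t) *\<^sub>R (horizontal ((s t * s t) *\<^sub>R y t) + 0)
        + (- \<beta> t / s t) *\<^sub>R (horizontal (x t) + e_z)) (at t)"
      by (rule has_vector_derivative_scaleR)
    then show ?thesis
      unfolding r_eq[abs_def] v_def
      by (rule has_vector_derivative_eq_rhs) (use s_pos[of t] in \<open>simp add: J.scaleR\<close>)
  qed
  define B where "B t = (s t * s t) *\<^sub>R y t \<bullet> y t + x t \<bullet> y' t" for t
  have \<beta>': "(\<beta> has_real_derivative B t) (at t)" for t
    unfolding \<beta>_def[abs_def] B_def by (rule has_real_derivative_inner[OF x' y'])
  define v' where "v' t = - (\<beta> t *\<^sub>R v t + B t *\<^sub>R r t) +
      (s t *\<^sub>R horizontal (y' t) + (\<beta> t * s t) *\<^sub>R horizontal (y t))" for t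
  have v': "(v has_vector_derivative v' t) (at t)" for t
    unfolding v_def[abs_def] v'_def scaleR_minus_left
    by (intro has_vector_derivative_add has_vector_derivative_minus has_vector_derivative_scaleR
        J.has_vector_derivative \<beta>' s' r'[unfolded v_def scaleR_minus_left] y')
  \<comment> \<open>Read off as \<open>m\<close> times the coefficient of \<open>r\<close> in
    \<open>v'\<close>. The two terms \<open>\<beta> t *\<^sub>R v t\<close> in \<open>v'\<close>
    cancel, which leaves friction as the only term in \<open>v\<close>.\<close>
  define \<Lambda> where "\<Lambda> t = m * (- B t + \<beta> t * \<beta> t - c * \<beta> t + g * s t)" for t
  have eq: "m *\<^sub>R v' t = \<Lambda> t *\<^sub>R r t - (m * g) *\<^sub>R e_z - m *\<^sub>R horizontal (a t) - \<gamma> *\<^sub>R v t" for t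
  proof -
    \<comment> \<open>The chart variables are eliminated in favour of \<open>r\<close>,
      \<open>v\<close> and \<open>e_z\<close>, the vectors in which the pendulum equation is
      written.\<close>
    have Jy: "s t *\<^sub>R horizontal (y t) = v t + \<beta> t *\<^sub>R r t"
      by (simp add: v_def)
    have Jx: "horizontal (x t) = s t *\<^sub>R r t - e_z"
      using s_pos[of t] by (simp add: r_eq)
    have "s t *\<^sub>R horizontal (y' t) =
        - c *\<^sub>R (s t *\<^sub>R horizontal (y t)) + g *\<^sub>R horizontal (x t) - horizontal (a t)"
      using s_pos[of t] by (simp add: y'_def J.add J.diff J.scaleR J.neg algebra_simps)
    also have "\<dots> = - c *\<^sub>R (v t + \<beta> t *\<^sub>R r t) + g *\<^sub>R (s t *\<^sub>R r t - e_z) - horizontal (a t)"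
      unfolding Jy Jx ..
    finally have Jy': "s t *\<^sub>R horizontal (y' t) = \<dots>" .
    have "(\<beta> t * s t) *\<^sub>R horizontal (y t) = \<beta> t *\<^sub>R (v t + \<beta> t *\<^sub>R r t)"
      by (simp flip: Jy)
    then have "v' t = (- B t + \<beta> t * \<beta> t - c * \<beta> t + g * s t) *\<^sub>R r t
        - g *\<^sub>R e_z - horizontal (a t) - c *\<^sub>R v t"
      unfolding v'_def Jy' by (simp add: algebra_simps)
    moreover have "\<gamma> = m * c"
      using m by (simp add: c_def)
    ultimately show ?thesis
      by (simp add: \<Lambda>_def scaleR_diff_right)
  qed
  have cr: "curve_deriv r = v" and cv: "curve_deriv v = v'"
    using r' v' by (auto intro: curve_deriv_eqI)
  have S2: "r t \<in> S2" for t
    by (simp only: r_def gnomonic_S2)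
  have "pendulum_solution m g \<gamma> \<rho> (r 0) (v 0) r"
    unfolding pendulum_solution_def cr cv \<rho>
    using S2 eq differentiableI_vector[OF r'] differentiableI_vector[OF v'] by blast
  moreover have "v 0 \<in> tangent_S2 (r 0)"
  proof -
    have "r 0 \<bullet> r 0 = 1"
      using S2[of 0] by (simp add: dot_square_norm)
    moreover have "s 0 * (horizontal (y 0) \<bullet> r 0) = \<beta> 0"
      using s_pos[of 0] by (simp add: r_eq inner_add_right \<beta>_def inner_commute)
    ultimately show ?thesis
      by (simp add: tangent_S2_def v_def inner_diff_left)
  qed
  ultimately show ?thesis
    using S2[of 0] unfolding r_def[abs_def] by blast
qed

theorem theorem3p9:
  fixes m g \<gamma> :: real and \<xi> \<eta> :: "real \<Rightarrow> real"
  assumes "m > 0" and "g > 0"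
    and "smooth \<xi>" and "smooth \<eta>"
    and "\<And>t. \<xi> (t + 2 * pi) = \<xi> t" and "\<And>t. \<eta> (t + 2 * pi) = \<eta> t"
    and "\<gamma> > 0"
  shows "\<exists>r0 \<in> S2. \<exists>v0 \<in> tangent_S2 r0. \<exists>r.
           pendulum_solution m g \<gamma> (pivot \<xi> \<eta>) r0 v0 r \<and>
           (\<forall>t. r (t + 2 * pi) = r t) \<and>
           (\<forall>t. r t \<bullet> e_z > 0)"
proof -
  \<comment> \<open>The acceleration of the pivot, as a forcing in the plane; it inherits continuity
    from smoothness and the period from \<xi> and \<eta>.\<close>
  define a where "a t = Complex (deriv (deriv \<xi>) t) (deriv (deriv \<eta>) t)" for t
  have a: "continuous_on UNIV a"
    unfolding a_def[abs_def] by (intro continuous_on_Complex smooth_deriv assms)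
  have aT: "a (t + 2 * pi) = a t" for t
    using assms(5,6) by (simp add: a_def deriv_periodic)
  have "2 * pi > 0" "\<gamma> / m > 0"
    using assms by simp_all
  then obtain x y where
        x: "\<And>t. (x has_vector_derivative (1 + (norm (x t))\<^sup>2) *\<^sub>R y t) (at t)"
    and y: "\<And>t. (y has_vector_derivative - (\<gamma> / m) *\<^sub>R y t +
          (1 / sqrt (1 + (norm (x t))\<^sup>2)) *\<^sub>R (g *\<^sub>R x t - a t)) (at t)"
    and xT: "\<And>t. x (t + 2 * pi) = x t"
    using gnomonic_periodic_solution[OF a aT] \<open>g > 0\<close> by metis
  have "curve_deriv (curve_deriv (pivot \<xi> \<eta>)) t = horizontal (a t)" for t
    by (simp add: curve_deriv_pivot assms a_def)
  from gnomonic_pendulum_solution[OF \<open>m > 0\<close> x y this]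
  obtain r0 v0 where "r0 \<in> S2" "v0 \<in> tangent_S2 r0"
    "pendulum_solution m g \<gamma> (pivot \<xi> \<eta>) r0 v0 (\<lambda>t. gnomonic (x t))"
    by blast
  then show ?thesis
    using xT gnomonic_upper by (metis (no_types, lifting))
qed

end
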